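(* If a node in the graphical representation of the Ising model is isolated, i.e. if $k\in\mathcal{N}$ is such that $\theta_{kj}=0$ for all $j\in\mathcal{N}\setminus\{k\}$, then the corresponding product $k$ belongs to the optimal assortment.
   Context: Let $\mathcal{N}=\{1,\dots,n\}$ be a set of products and $\theta\in\mathbb{S}^n$ a real symmetric $n\times n$ matrix. An assortment is a subset $S\subseteq\mathcal{N}$; a basket from $S$ is a vector $x\in\mathcal{X}(S)=\{0,1\}^{S}$, where $x_i=1$ means that product $i$ is in the basket. Under the (binary) Ising model with parameters $\theta$, the probability that a random customer offered $S$ selects basket $x$ is $$p_\theta(x\mid S)=\frac{\exp\bigl(\sum_{i\in S}\theta_{ii}x_i+\sum_{i\ne j,\ i,j\in S}x_i\theta_{ij}x_j\bigr)}{\sum_{y\in\mathcal{X}(S)}\exp\bigl(\sum_{i\in S}\theta_{ii}y_i+\sum_{i\ne j,\ i,j\in S}y_i\theta_{ij}y_j\bigr)},$$ where the sum over $i\ne j$ runs over ordered pairs. Let $r_j$ denote the gross profit (alternatively, the revenue) per unit of product $j\in\mathcal{N}$. The expected profit generated by a random customer given assortment $S$ is $R(S)=\sum_{x\in\mathcal{X}(S)}p_\theta(x\mid S)\sum_{j\in S}r_jx_j$. The assortment optimization problem is $\max_{S\subseteq\mathcal{N}}R(S)$, and the optimal assortment is its optimal solution. The graphical representation of the model is the weighted graph with node set $\mathcal{N}$ in which distinct nodes $i,j$ are joined by an edge of weight $\theta_{ij}$ if and only if $\theta_{ij}\ne 0$.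
   Formalization: Profit r_k of the isolated product is assumed nonnegative (the claim fails whenever r_k<0); as optima need not be unique, some optimal assortment contains k if r_k≥0, and every optimal assortment contains k if r_k>0. *)

theory Defs
  imports "HOL-Analysis.Analysis"
begin

text \<open>
  The set of products is the whole of the finite index type \<open>'n\<close>, with \<open>CARD('n)\<close> playing the role
  of the number of products; an assortment is an arbitrary \<open>S :: 'n set\<close>.
  A basket from \<open>S\<close> is a \<open>{0,1}\<close>-valued function on \<open>S\<close>, represented extensionally
  (\<open>undefined\<close> outside \<open>S\<close>) so that each basket is counted exactly once in sums.
\<close>

definition baskets :: "'n set \<Rightarrow> ('n \<Rightarrow> real) set" where
  "baskets S = S \<rightarrow>\<^sub>E {0, 1}"

text \<open>The interaction sum runs over ordered pairs, so each unordered pair contributes twice.\<close>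

definition ising_exponent :: "real^'n^'n \<Rightarrow> 'n::finite set \<Rightarrow> ('n \<Rightarrow> real) \<Rightarrow> real" where
  "ising_exponent \<theta> S x =
     (\<Sum>i\<in>S. \<theta> $ i $ i * x i) +
     (\<Sum>(i, j)\<in>{(i, j). i \<in> S \<and> j \<in> S \<and> i \<noteq> j}. x i * \<theta> $ i $ j * x j)"

definition ising_prob :: "real^'n^'n \<Rightarrow> 'n::finite set \<Rightarrow> ('n \<Rightarrow> real) \<Rightarrow> real" where
  "ising_prob \<theta> S x =
     exp (ising_exponent \<theta> S x) / (\<Sum>y\<in>baskets S. exp (ising_exponent \<theta> S y))"

definition expected_profit :: "real^'n^'n \<Rightarrow> ('n \<Rightarrow> real) \<Rightarrow> 'n::finite set \<Rightarrow> real" where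
  "expected_profit \<theta> r S = (\<Sum>x\<in>baskets S. ising_prob \<theta> S x * (\<Sum>j\<in>S. r j * x j))"

definition optimal_assortment :: "real^'n^'n \<Rightarrow> ('n \<Rightarrow> real) \<Rightarrow> 'n::finite set \<Rightarrow> bool" where
  "optimal_assortment \<theta> r S \<longleftrightarrow> is_arg_max (expected_profit \<theta> r) (\<lambda>T. T \<subseteq> UNIV) S"

definition ising_adjacent :: "real^'n^'n \<Rightarrow> 'n::finite \<Rightarrow> 'n \<Rightarrow> bool" where
  "ising_adjacent \<theta> i j \<longleftrightarrow> i \<noteq> j \<and> \<theta> $ i $ j \<noteq> 0"

definition isolated_node :: "real^'n^'n \<Rightarrow> 'n::finite \<Rightarrow> bool" where
  "isolated_node \<theta> k \<longleftrightarrow> (\<forall>j. \<not> ising_adjacent \<theta> k j)"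

end

theory Submission imports Defs begin

text \<open>
  An isolated product \<open>k\<close> does not interact with any other product, so the exponent of a basket
  from \<open>insert k S\<close> is the exponent of its restriction to \<open>S\<close> plus \<open>\<theta> $ k $ k\<close> times the
  indicator of buying \<open>k\<close> (\<open>ising_exponent_insert_isolated\<close>). Hence the model on \<open>insert k S\<close> is a
  product distribution: the purchase of \<open>k\<close> is an independent Bernoulli variable with the logistic
  success probability \<open>exp a / (1 + exp a)\<close>, \<open>a = \<theta> $ k $ k\<close>, and the rest of the basket is
  distributed as a basket from \<open>S\<close>. Offering \<open>k\<close> in addition to \<open>S\<close> therefore leaves the profit from
  \<open>S\<close> unchanged and adds exactly \<open>r k * exp a / (1 + exp a)\<close>
  (\<open>expected_profit_insert_isolated\<close>). This gain has the sign of \<open>r k\<close>. There are finitely many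
  assortments, so an optimal one exists; adding \<open>k\<close> to it keeps it optimal if \<open>0 \<le> r k\<close>, and
  would improve it strictly if \<open>0 < r k\<close> and \<open>k\<close> were missing.
\<close>

lemma finite_baskets: "finite (baskets (S :: 'n::finite set))"
  unfolding baskets_def by (intro finite_PiE) auto

lemma baskets_nonempty: "baskets S \<noteq> {}"
  unfolding baskets_def by (simp add: PiE_eq_empty_iff)

lemma sum_baskets_insert:
  fixes S :: "'n::finite set" and F :: "('n \<Rightarrow> real) \<Rightarrow> real"
  assumes "k \<notin> S"
  shows "(\<Sum>x\<in>baskets (insert k S). F x) = (\<Sum>x\<in>baskets S. F (x(k := 0)) + F (x(k := 1)))"
proof -
  let ?extend = "\<lambda>(c, x). x(k := c)"
  have image: "baskets (insert k S) = ?extend ` ({0, 1} \<times> baskets S)"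
    unfolding baskets_def by (simp add: PiE_insert_eq)
  have inj: "inj_on ?extend ({0, 1} \<times> baskets S)"
    using inj_combinator[OF assms, of "\<lambda>_. {0, 1 :: real}"] by (simp add: baskets_def)
  have "(\<Sum>x\<in>baskets (insert k S). F x) = (\<Sum>(c, x)\<in>{0, 1} \<times> baskets S. F (x(k := c)))"
    unfolding image sum.reindex[OF inj] by (intro sum.cong) auto
  also have "\<dots> = (\<Sum>c\<in>{0, 1}. \<Sum>x\<in>baskets S. F (x(k := c)))"
    by (rule sum.cartesian_product[symmetric])
  finally show ?thesis
    by (simp add: sum.distrib)
qed

lemma ising_exponent_insert_isolated:
  fixes \<theta> :: "real^'n^'n" and S :: "'n::finite set"
  assumes symmetric: "transpose \<theta> = \<theta>" and isolated: "isolated_node \<theta> k" and "k \<notin> S"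
  shows "ising_exponent \<theta> (insert k S) (x(k := c)) = \<theta> $ k $ k * c + ising_exponent \<theta> S x"
proof -
  have row: "\<theta> $ k $ j = 0" if "j \<noteq> k" for j
    using isolated that by (auto simp: isolated_node_def ising_adjacent_def)
  \<comment> \<open>Isolation is a statement about row \<open>k\<close>; the ordered pairs ending in \<open>k\<close> need column \<open>k\<close>.\<close>
  have column: "\<theta> $ j $ k = 0" if "j \<noteq> k" for j
    using row[OF that] symmetric by (metis transpose_def vec_lambda_beta)
  let ?pairs = "\<lambda>S. {(i, j). i \<in> S \<and> j \<in> S \<and> i \<noteq> j}"
  have "(\<Sum>(i, j)\<in>?pairs (insert k S). (x(k := c)) i * \<theta> $ i $ j * (x(k := c)) j)
      = (\<Sum>(i, j)\<in>?pairs S. (x(k := c)) i * \<theta> $ i $ j * (x(k := c)) j)"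
    by (rule sum.mono_neutral_right) (auto simp: row column)
  also have "\<dots> = (\<Sum>(i, j)\<in>?pairs S. x i * \<theta> $ i $ j * x j)"
    using \<open>k \<notin> S\<close> by (intro sum.cong) auto
  finally have interaction:
    "(\<Sum>(i, j)\<in>?pairs (insert k S). (x(k := c)) i * \<theta> $ i $ j * (x(k := c)) j)
      = (\<Sum>(i, j)\<in>?pairs S. x i * \<theta> $ i $ j * x j)" .
  have "(\<Sum>i\<in>S. \<theta> $ i $ i * (x(k := c)) i) = (\<Sum>i\<in>S. \<theta> $ i $ i * x i)"
    using \<open>k \<notin> S\<close> by (intro sum.cong) auto
  then show ?thesis
    unfolding ising_exponent_def interaction using \<open>k \<notin> S\<close> by simp
qed

text \<open>
  With \<open>Z\<close> the partition function and \<open>N\<close> the unnormalised profit on \<open>S\<close>, splitting the baskets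
  by whether they contain \<open>k\<close> gives the partition function \<open>(1 + exp a) * Z\<close> and the unnormalised
  profit \<open>(1 + exp a) * N + r k * exp a * Z\<close> on \<open>insert k S\<close>; the gain is what remains in their
  quotient besides \<open>N / Z\<close>.
\<close>

lemma expected_profit_insert_isolated:
  fixes \<theta> :: "real^'n^'n" and S :: "'n::finite set"
  assumes symmetric: "transpose \<theta> = \<theta>" and isolated: "isolated_node \<theta> k" and "k \<notin> S"
  shows "expected_profit \<theta> r (insert k S)
       = expected_profit \<theta> r S + r k * (exp (\<theta> $ k $ k) / (1 + exp (\<theta> $ k $ k)))"
proof -
  define a where "a = \<theta> $ k $ k"
  define w where "w = (\<lambda>S x. exp (ising_exponent \<theta> S x))"
  define P where "P = (\<lambda>S x. \<Sum>j\<in>S. r j * x j)"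
  define Z where "Z = (\<lambda>S. \<Sum>x\<in>baskets S. w S x)"
  define N where "N = (\<lambda>S. \<Sum>x\<in>baskets S. w S x * P S x)"
  have profit: "expected_profit \<theta> r T = N T / Z T" for T
    by (simp add: expected_profit_def ising_prob_def N_def Z_def w_def P_def sum_divide_distrib)
  have weight: "w (insert k S) (x(k := c)) = exp (a * c) * w S x" for x c
    using ising_exponent_insert_isolated[OF assms, of x c] by (simp add: w_def a_def exp_add)
  have "(\<Sum>j\<in>S. r j * (x(k := c)) j) = (\<Sum>j\<in>S. r j * x j)" for x c
    using \<open>k \<notin> S\<close> by (intro sum.cong) auto
  then have basket_profit: "P (insert k S) (x(k := c)) = r k * c + P S x" for x c
    using \<open>k \<notin> S\<close> by (simp add: P_def)
  have "Z (insert k S) = (\<Sum>x\<in>baskets S. (1 + exp a) * w S x)"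
    by (simp add: Z_def sum_baskets_insert[OF \<open>k \<notin> S\<close>] weight algebra_simps)
  then have Z_insert: "Z (insert k S) = (1 + exp a) * Z S"
    by (simp add: Z_def sum_distrib_left)
  have "N (insert k S) = (\<Sum>x\<in>baskets S. (1 + exp a) * (w S x * P S x) + r k * exp a * w S x)"
    by (simp add: N_def sum_baskets_insert[OF \<open>k \<notin> S\<close>] weight basket_profit algebra_simps)
  then have N_insert: "N (insert k S) = (1 + exp a) * N S + r k * exp a * Z S"
    by (simp add: N_def Z_def sum.distrib sum_distrib_left)
  have "0 < Z S"
    unfolding Z_def w_def by (intro sum_pos finite_baskets baskets_nonempty) simp
  moreover have "0 < 1 + exp a"
    by (simp add: add_pos_pos)
  ultimately have "N (insert k S) / Z (insert k S) = N S / Z S + r k * (exp a / (1 + exp a))"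
    unfolding Z_insert N_insert by (simp add: divide_simps)
  then show ?thesis
    by (simp add: profit a_def)
qed

lemma optimal_assortment_iff:
  "optimal_assortment \<theta> r S \<longleftrightarrow> (\<forall>T. expected_profit \<theta> r T \<le> expected_profit \<theta> r S)"
  by (auto simp: optimal_assortment_def is_arg_max_def not_less)

lemma ex_optimal_assortment: "\<exists>S. optimal_assortment \<theta> r S"
proof -
  have "Max (range (expected_profit \<theta> r)) \<in> range (expected_profit \<theta> r)"
    by (intro Max_in) auto
  then obtain S where "expected_profit \<theta> r S = Max (range (expected_profit \<theta> r))"
    by force
  then show ?thesis
    unfolding optimal_assortment_iff by (metis Max_ge finite finite_imageI rangeI)
qed

theorem proposition2:
  fixes \<theta> :: "real^'n^'n" and r :: "'n::finite \<Rightarrow> real" and k :: 'n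
  assumes symmetric: "transpose \<theta> = \<theta>"
    and isolated: "isolated_node \<theta> k"
    and profit: "0 \<le> r k"
  shows "(\<exists>S. optimal_assortment \<theta> r S \<and> k \<in> S) \<and>
         (0 < r k \<longrightarrow> (\<forall>S. optimal_assortment \<theta> r S \<longrightarrow> k \<in> S))"
proof (intro conjI impI allI)
  define q where "q = exp (\<theta> $ k $ k) / (1 + exp (\<theta> $ k $ k))"
  have "0 < q"
    by (simp add: q_def add_pos_pos)
  have gain: "expected_profit \<theta> r (insert k S) = expected_profit \<theta> r S + r k * q" if "k \<notin> S" for S
    unfolding q_def by (rule expected_profit_insert_isolated[OF symmetric isolated that])
  show "\<exists>S. optimal_assortment \<theta> r S \<and> k \<in> S"
  proof -
    obtain S where S: "optimal_assortment \<theta> r S"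
      using ex_optimal_assortment by blast
    have "expected_profit \<theta> r S \<le> expected_profit \<theta> r (insert k S)"
      using gain[of S] profit \<open>0 < q\<close> by (cases "k \<in> S") (auto simp: insert_absorb)
    then have "optimal_assortment \<theta> r (insert k S)"
      using S unfolding optimal_assortment_iff by (meson order_trans)
    then show ?thesis by blast
  qed
  show "k \<in> S" if "0 < r k" and S: "optimal_assortment \<theta> r S" for S
  proof (rule ccontr)
    assume "k \<notin> S"
    then have "expected_profit \<theta> r S < expected_profit \<theta> r (insert k S)"
      using gain \<open>0 < r k\<close> \<open>0 < q\<close> by simp
    with S show False
      unfolding optimal_assortment_iff by (meson not_less)
  qed
qed

end
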